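(* Let $R$ be a commutative ring with identity. Then $\chi(\mathbb{AG}(R))=1$ if and only if $R$ has only one nonzero proper ideal (i.e. exactly one).
   Context: An ideal $I$ of $R$ is an annihilating-ideal if $\mathrm{Ann}(I)\neq(0)$, i.e. there is a nonzero ideal $J$ of $R$ with $IJ=(0)$. The annihilating-ideal graph $\mathbb{AG}(R)$ is the undirected simple graph whose vertices are the nonzero annihilating-ideals of $R$, where two distinct vertices $I,J$ are adjacent if and only if $IJ=(0)$. $\chi(G)$ denotes the chromatic number of a graph $G$. *)

theory Defs
  imports "HOL-Algebra.Ideal_Product" "HOL-Library.Extended_Nat"
begin

section \<open>Undirected simple graphs and the chromatic number\<close>

text \<open>Edges are unordered pairs of distinct vertices; no finiteness is assumed.\<close>

record 'v graph =
  vertices :: "'v set"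
  edges :: "'v set set"

definition simple_graph :: "('v, 'm) graph_scheme \<Rightarrow> bool" where
  "simple_graph G \<longleftrightarrow>
     (\<forall>e \<in> edges G. \<exists>u v. u \<in> vertices G \<and> v \<in> vertices G \<and> u \<noteq> v \<and> e = {u, v})"

definition adjacent :: "('v, 'm) graph_scheme \<Rightarrow> 'v \<Rightarrow> 'v \<Rightarrow> bool" where
  "adjacent G u v \<longleftrightarrow> {u, v} \<in> edges G"

definition proper_colouring :: "('v, 'm) graph_scheme \<Rightarrow> nat \<Rightarrow> ('v \<Rightarrow> nat) \<Rightarrow> bool" where
  "proper_colouring G k c \<longleftrightarrow>
     c ` vertices G \<subseteq> {..<k} \<and>
     (\<forall>u \<in> vertices G. \<forall>v \<in> vertices G. adjacent G u v \<longrightarrow> c u \<noteq> c v)"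

text \<open>The least number of colours of a proper colouring. It is \<open>\<infinity>\<close> (the infimum of the empty
  set) if no finite number of colours suffices, and \<open>0\<close> exactly for the graph without vertices.\<close>

definition chromatic_number :: "('v, 'm) graph_scheme \<Rightarrow> enat" (\<open>\<chi>\<close>) where
  "\<chi> G = Inf {enat k | k. \<exists>c. proper_colouring G k c}"

section \<open>The annihilating-ideal graph\<close>

definition annihilator :: "('a, 'm) ring_scheme \<Rightarrow> 'a set \<Rightarrow> 'a set" where
  "annihilator R I = {a \<in> carrier R. \<forall>x \<in> I. a \<otimes>\<^bsub>R\<^esub> x = \<zero>\<^bsub>R\<^esub>}"

definition annihilating_ideal :: "('a, 'm) ring_scheme \<Rightarrow> 'a set \<Rightarrow> bool" where
  "annihilating_ideal R I \<longleftrightarrow> ideal I R \<and> annihilator R I \<noteq> {\<zero>\<^bsub>R\<^esub>}"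

definition annihilating_ideal_graph :: "('a, 'm) ring_scheme \<Rightarrow> 'a set graph" (\<open>\<bbbA>\<bbbG>\<close>) where
  "\<bbbA>\<bbbG> R =
     (let V = {I. annihilating_ideal R I \<and> I \<noteq> {\<zero>\<^bsub>R\<^esub>}} in
      \<lparr>vertices = V,
       edges = {{I, J} | I J. I \<in> V \<and> J \<in> V \<and> I \<noteq> J \<and> I \<cdot>\<^bsub>R\<^esub> J = {\<zero>\<^bsub>R\<^esub>}}\<rparr>)"

lemma (in cring) ideal_annihilator:
  assumes "ideal I R"
  shows "ideal (annihilator R I) R"
proof -
  interpret I: ideal I R by fact
  let ?A = "annihilator R I"
  have "subgroup ?A (add_monoid R)"
  proof (rule group.subgroupI[OF add.is_group])
    show "?A \<subseteq> carrier (add_monoid R)"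
      by (auto simp: annihilator_def)
    have "\<zero> \<in> ?A"
      by (simp add: annihilator_def)
    then show "?A \<noteq> {}" by blast
  next
    fix a assume "a \<in> ?A"
    then have "\<ominus> a \<in> ?A"
      by (simp add: annihilator_def l_minus)
    then show "inv\<^bsub>add_monoid R\<^esub> a \<in> ?A"
      by (simp add: a_inv_def)
  next
    fix a b assume "a \<in> ?A" "b \<in> ?A"
    then show "a \<otimes>\<^bsub>add_monoid R\<^esub> b \<in> ?A"
      by (simp add: annihilator_def l_distr)
  qed
  moreover have left: "x \<otimes> a \<in> ?A" if "a \<in> ?A" "x \<in> carrier R" for a x
    using that by (simp add: annihilator_def m_assoc)
  moreover have "a \<otimes> x \<in> ?A" if "a \<in> ?A" "x \<in> carrier R" for a x
  proof -
    have "a \<otimes> x = x \<otimes> a"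
      using that by (intro m_comm) (auto simp: annihilator_def)
    then show ?thesis using left[OF that] by simp
  qed
  ultimately show ?thesis
    by (intro idealI ring_axioms)
qed

lemma (in cring) ideal_prod_eq_zero_iff:
  assumes "ideal I R" "ideal J R"
  shows "I \<cdot> J = {\<zero>} \<longleftrightarrow> J \<subseteq> annihilator R I"
proof
  interpret I: ideal I R by fact
  interpret J: ideal J R by fact
  show "J \<subseteq> annihilator R I" if "I \<cdot> J = {\<zero>}"
  proof
    fix j assume j: "j \<in> J"
    have "i \<otimes> j = \<zero>" if "i \<in> I" for i
      using ideal_prod.prod[OF that j, of R] \<open>I \<cdot> J = {\<zero>}\<close> by simp
    then show "j \<in> annihilator R I"
      using j m_comm by (fastforce simp: annihilator_def)
  qed
  show "I \<cdot> J = {\<zero>}" if sub: "J \<subseteq> annihilator R I"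
  proof -
    have "s = \<zero>" if "s \<in> I \<cdot> J" for s
      using that
    proof induct
      case (prod i j)
      then have "j \<otimes> i = \<zero>" using sub by (auto simp: annihilator_def)
      then show ?case using prod m_comm[of i j] by simp
    qed simp
    moreover have "\<zero> \<in> I \<cdot> J"
      using ideal_prod.prod[of \<zero> I \<zero> J R] by simp
    ultimately show ?thesis by blast
  qed
qed

lemma (in cring) annihilating_ideal_iff:
  "annihilating_ideal R I \<longleftrightarrow> ideal I R \<and> (\<exists>J. ideal J R \<and> J \<noteq> {\<zero>} \<and> I \<cdot> J = {\<zero>})"
proof (cases "ideal I R")
  case True
  show ?thesis
  proof
    assume "annihilating_ideal R I"
    then have "annihilator R I \<noteq> {\<zero>}" by (simp add: annihilating_ideal_def)
    moreover have "I \<cdot> annihilator R I = {\<zero>}"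
      using ideal_prod_eq_zero_iff[OF True ideal_annihilator[OF True]] by simp
    ultimately show "ideal I R \<and> (\<exists>J. ideal J R \<and> J \<noteq> {\<zero>} \<and> I \<cdot> J = {\<zero>})"
      using True ideal_annihilator[OF True] by blast
  next
    assume "ideal I R \<and> (\<exists>J. ideal J R \<and> J \<noteq> {\<zero>} \<and> I \<cdot> J = {\<zero>})"
    then obtain J where J: "ideal J R" "J \<noteq> {\<zero>}" and "I \<cdot> J = {\<zero>}"
      by blast
    then have "J \<subseteq> annihilator R I"
      using ideal_prod_eq_zero_iff[OF True] by simp
    moreover have "\<zero> \<in> J"
      using J(1) by (intro additive_subgroup.zero_closed ideal.axioms(1))
    ultimately have "annihilator R I \<noteq> {\<zero>}"
      using J(2) by blast
    then show "annihilating_ideal R I"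
      using True by (simp add: annihilating_ideal_def)
  qed
qed (simp add: annihilating_ideal_def)

lemma simple_graph_annihilating_ideal_graph: "simple_graph (\<bbbA>\<bbbG> R)"
  unfolding simple_graph_def
proof
  fix e assume "e \<in> edges (\<bbbA>\<bbbG> R)"
  then obtain I J where "e = {I, J}" "I \<in> vertices (\<bbbA>\<bbbG> R)" "J \<in> vertices (\<bbbA>\<bbbG> R)" "I \<noteq> J"
    unfolding annihilating_ideal_graph_def Let_def graph.simps mem_Collect_eq
    by (elim exE conjE) simp
  then show "\<exists>u v. u \<in> vertices (\<bbbA>\<bbbG> R) \<and> v \<in> vertices (\<bbbA>\<bbbG> R) \<and> u \<noteq> v \<and> e = {u, v}"
    by (intro exI[of _ I] exI[of _ J] conjI)
qed

lemma (in cring) adjacent_annihilating_ideal_graph_iff: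
  "adjacent (\<bbbA>\<bbbG> R) I J \<longleftrightarrow>
     I \<in> vertices (\<bbbA>\<bbbG> R) \<and> J \<in> vertices (\<bbbA>\<bbbG> R) \<and> I \<noteq> J \<and> I \<cdot> J = {\<zero>}"
proof -
  let ?V = "{I. annihilating_ideal R I \<and> I \<noteq> {\<zero>}}"
  have comm: "I \<cdot> J = J \<cdot> I" if "I \<in> ?V" "J \<in> ?V"
    using that ideal_prod_commute by (simp add: annihilating_ideal_def)
  have "adjacent (\<bbbA>\<bbbG> R) I J \<longleftrightarrow>
      (\<exists>I' J'. {I, J} = {I', J'} \<and> I' \<in> ?V \<and> J' \<in> ?V \<and> I' \<noteq> J' \<and> I' \<cdot> J' = {\<zero>})"
    by (simp add: adjacent_def annihilating_ideal_graph_def)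
  also have "\<dots> \<longleftrightarrow> I \<in> ?V \<and> J \<in> ?V \<and> I \<noteq> J \<and> I \<cdot> J = {\<zero>}"
  proof
    assume "\<exists>I' J'. {I, J} = {I', J'} \<and> I' \<in> ?V \<and> J' \<in> ?V \<and> I' \<noteq> J' \<and> I' \<cdot> J' = {\<zero>}"
    then obtain I' J' where eq: "{I, J} = {I', J'}"
      and V: "I' \<in> ?V" "J' \<in> ?V" "I' \<noteq> J'" and zero: "I' \<cdot> J' = {\<zero>}"
      by (elim exE conjE)
    from eq consider "I = I'" "J = J'" | "I = J'" "J = I'"
      by (metis doubleton_eq_iff)
    then show "I \<in> ?V \<and> J \<in> ?V \<and> I \<noteq> J \<and> I \<cdot> J = {\<zero>}"
    proof cases
      case 1
      then show ?thesis using V zero by simp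
    next
      case 2
      then have "I \<cdot> J = J \<cdot> I" using V by (intro comm) simp_all
      then show ?thesis using 2 V zero by simp
    qed
  next
    assume *: "I \<in> ?V \<and> J \<in> ?V \<and> I \<noteq> J \<and> I \<cdot> J = {\<zero>}"
    show "\<exists>I' J'. {I, J} = {I', J'} \<and> I' \<in> ?V \<and> J' \<in> ?V \<and> I' \<noteq> J' \<and> I' \<cdot> J' = {\<zero>}"
      by (rule exI[of _ I], rule exI[of _ J]) (use * in simp)
  qed
  finally show ?thesis
    by (simp add: annihilating_ideal_graph_def)
qed

end

theory Submission
  imports Defs
begin

text \<open>A graph has chromatic number 1 iff it has a vertex and no edge, so the question is when
  \<open>\<bbbA>\<bbbG> R\<close> is nonempty and edgeless.

  Every vertex \<open>I\<close> multiplies its annihilator to zero, and \<open>Ann I\<close> is itself a vertex.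
  In an edgeless graph this forces \<open>Ann I = I\<close>. Two distinct vertices \<open>I\<close> and \<open>J\<close> cannot meet in
  zero only, since \<open>I \<cdot> J \<subseteq> I \<inter> J\<close>, and for a nonzero \<open>x\<close> in \<open>I \<inter> J\<close> the chain
  \<open>(x) \<subseteq> I = Ann I \<subseteq> Ann (x) = (x)\<close> gives \<open>I = (x) = J\<close>. So there is a single vertex \<open>I\<close>; it
  satisfies \<open>Ann I = I\<close>, and each of its nonzero elements generates it. If \<open>y\<close> lies outside
  \<open>I = Ann I\<close>, then \<open>y x \<noteq> 0\<close> for some \<open>x \<in> I\<close>; this product generates \<open>I\<close>, whence
  \<open>x = r y x\<close> for some \<open>r\<close>, so that \<open>1 - r y\<close> belongs to \<open>Ann (x) = Ann I = I\<close>. As \<open>I\<close> squares to zero, \<open>1 - r y\<close> is nilpotent and \<open>y\<close> is a unit. Hence a proper ideal is contained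
  in \<open>I\<close>, and if it is nonzero it equals \<open>I\<close>.

  Conversely let \<open>I\<close> be the only nonzero proper ideal. If \<open>x \<in> I\<close> were nonzero and not a zero
  divisor, \<open>(x)\<close> and \<open>(x\<^sup>2)\<close> would both equal \<open>I\<close>, and cancelling \<open>x\<close> in \<open>x = r x\<^sup>2\<close> would make
  \<open>x\<close> a unit. So \<open>I\<close> is a vertex, and it is the only one because the annihilator of \<open>R\<close> is
  zero.\<close>

section \<open>Graphs of chromatic number one\<close>

lemma chromatic_number_eq_1_iff:
  "\<chi> G = 1 \<longleftrightarrow>
     vertices G \<noteq> {} \<and> (\<forall>u \<in> vertices G. \<forall>v \<in> vertices G. \<not> adjacent G u v)"
proof -
  define S where "S = {enat k | k. \<exists>c. proper_colouring G k c}"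
  have chi: "\<chi> G = Inf S"
    by (simp add: chromatic_number_def S_def)
  have zero: "0 \<in> S \<longleftrightarrow> vertices G = {}"
    by (auto simp: S_def proper_colouring_def zero_enat_def)
  have one: "1 \<in> S \<longleftrightarrow> (\<forall>u \<in> vertices G. \<forall>v \<in> vertices G. \<not> adjacent G u v)"
  proof
    assume "1 \<in> S"
    then obtain c where "proper_colouring G 1 c"
      by (auto simp: S_def one_enat_def)
    then show "\<forall>u \<in> vertices G. \<forall>v \<in> vertices G. \<not> adjacent G u v"
      by (auto simp: proper_colouring_def image_subset_iff)
  next
    assume "\<forall>u \<in> vertices G. \<forall>v \<in> vertices G. \<not> adjacent G u v"
    then have "proper_colouring G 1 (\<lambda>_. 0)"
      by (auto simp: proper_colouring_def)
    then show "1 \<in> S"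
      by (auto simp: S_def one_enat_def)
  qed
  have "Inf S = 1 \<longleftrightarrow> 0 \<notin> S \<and> 1 \<in> S"
  proof
    assume Inf: "Inf S = 1"
    then have "S \<noteq> {}"
      by (auto simp: Inf_enat_def)
    then have "Inf S \<in> S"
      by (auto simp: Inf_enat_def intro: LeastI)
    moreover have "0 \<notin> S"
      using Inf Inf_lower[of 0 S] by auto
    ultimately show "0 \<notin> S \<and> 1 \<in> S"
      using Inf by simp
  next
    assume S: "0 \<notin> S \<and> 1 \<in> S"
    have "1 \<le> s" if "s \<in> S" for s
      using that S by (metis ileI1 not_gr_zero one_eSuc)
    then show "Inf S = 1"
      using S by (intro antisym Inf_lower Inf_greatest) auto
  qed
  then show ?thesis
    using chi zero one by simp
qed

section \<open>Annihilators and vertices\<close>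

context cring
begin

lemma vertex_iff:
  "I \<in> vertices (\<bbbA>\<bbbG> R) \<longleftrightarrow> ideal I R \<and> I \<noteq> {\<zero>} \<and> annihilator R I \<noteq> {\<zero>}"
  by (auto simp: annihilating_ideal_graph_def annihilating_ideal_def)

lemma annihilator_antimono: "I \<subseteq> J \<Longrightarrow> annihilator R J \<subseteq> annihilator R I"
  by (auto simp: annihilator_def)

lemma annihilator_carrier: "annihilator R (carrier R) = {\<zero>}"
  by (auto simp: annihilator_def) (metis one_closed r_one)

lemma ideal_ne_zeroE:
  assumes "ideal I R" "I \<noteq> {\<zero>}"
  obtains x where "x \<in> I" "x \<noteq> \<zero>" "x \<in> carrier R"
proof -
  interpret ideal I R by fact
  show thesis
    using that assms(2) zero_closed Icarr by blast
qed

lemma cgenideal_ne_zero: "x \<in> carrier R \<Longrightarrow> x \<noteq> \<zero> \<Longrightarrow> PIdl x \<noteq> {\<zero>}"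
  using cgenideal_self by blast

lemma cgenideal_subset: "ideal I R \<Longrightarrow> x \<in> I \<Longrightarrow> PIdl x \<subseteq> I"
  by (rule cgenideal_minimal)

lemma annihilator_cgenidealI:
  assumes "x \<in> carrier R" "a \<in> carrier R" "a \<otimes> x = \<zero>"
  shows "a \<in> annihilator R (PIdl x)"
proof -
  have "a \<otimes> (s \<otimes> x) = \<zero>" if "s \<in> carrier R" for s
    using m_lcomm[of a s x] that assms by simp
  then show ?thesis
    using assms(2) by (auto simp: annihilator_def cgenideal_def)
qed

text \<open>The ideal \<open>I\<close> itself annihilates \<open>Ann I\<close> and is nonzero.\<close>

lemma annihilator_vertex:
  assumes "I \<in> vertices (\<bbbA>\<bbbG> R)"
  shows "annihilator R I \<in> vertices (\<bbbA>\<bbbG> R)"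
proof -
  have I: "ideal I R" "I \<noteq> {\<zero>}" "annihilator R I \<noteq> {\<zero>}"
    using assms by (auto simp: vertex_iff)
  interpret ideal I R by (rule I)
  have "I \<subseteq> annihilator R (annihilator R I)"
  proof
    fix x assume x: "x \<in> I"
    have "x \<otimes> a = \<zero>" if "a \<in> annihilator R I" for a
    proof -
      have "a \<in> carrier R" "a \<otimes> x = \<zero>"
        using that x by (auto simp: annihilator_def)
      then show ?thesis
        using x m_comm[of x a] by simp
    qed
    then show "x \<in> annihilator R (annihilator R I)"
      using x by (simp add: annihilator_def)
  qed
  then have "annihilator R (annihilator R I) \<noteq> {\<zero>}"
    using I(2) zero_closed by blast
  then show ?thesis
    using I ideal_annihilator by (simp add: vertex_iff)
qed

lemma nonzero_subideal_vertex:
  assumes "I \<in> vertices (\<bbbA>\<bbbG> R)" "ideal J R" "J \<noteq> {\<zero>}" "J \<subseteq> I"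
  shows "J \<in> vertices (\<bbbA>\<bbbG> R)"
proof -
  have "ideal (annihilator R I) R" "annihilator R I \<noteq> {\<zero>}"
    using assms(1) ideal_annihilator by (auto simp: vertex_iff)
  then have "annihilator R J \<noteq> {\<zero>}"
    using annihilator_antimono[OF assms(4)] ideal_ne_zeroE by blast
  then show ?thesis
    using assms by (simp add: vertex_iff)
qed

section \<open>Edgeless annihilating-ideal graphs\<close>

text \<open>A self-annihilating ideal that is the only vertex is also the only nonzero proper ideal:
  the elements outside it are units because they are units modulo an ideal of square zero.\<close>

lemma proper_ideal_eq_sole_vertex:
  assumes V: "vertices (\<bbbA>\<bbbG> R) = {I}" and ann: "annihilator R I = I"
    and K: "ideal K R" "K \<noteq> {\<zero>}" "K \<noteq> carrier R"
  shows "K = I"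
proof -
  have I: "ideal I R" "I \<noteq> {\<zero>}"
    using V vertex_iff by blast+
  interpret I: ideal I R by (rule I)
  interpret K: ideal K R by (rule K)
  have generates: "PIdl z = I" if "z \<in> I" "z \<noteq> \<zero>" for z
    using that V I nonzero_subideal_vertex[of I "PIdl z"]
    by (simp add: cgenideal_ideal cgenideal_ne_zero cgenideal_subset)
  have "K \<subseteq> I"
  proof
    fix y assume y: "y \<in> K"
    show "y \<in> I"
    proof (rule ccontr)
      assume "y \<notin> I"
      then have "y \<notin> annihilator R I"
        using ann by simp
      then obtain x where x: "x \<in> I" "y \<otimes> x \<noteq> \<zero>"
        using y by (auto simp: annihilator_def)
      have "y \<otimes> x \<in> I"
        using x y by (simp add: I.I_l_closed)
      then have "x \<in> PIdl (y \<otimes> x)"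
        using generates x by simp
      then obtain r where r: "r \<in> carrier R" "x = r \<otimes> (y \<otimes> x)"
        by (auto simp: cgenideal_def)
      define e where "e = \<one> \<ominus> r \<otimes> y"
      have e: "e \<in> carrier R"
        using r y by (simp add: e_def)
      have "e \<otimes> x = x \<ominus> r \<otimes> (y \<otimes> x)"
        using r(1) y x I.Icarr K.Icarr unfolding e_def by algebra
      then have ex: "e \<otimes> x = \<zero>"
        using r(2) x I.Icarr by (simp add: r_neg minus_eq)
      have "x \<noteq> \<zero>"
        using x y by auto
      then have "e \<in> I"
        using annihilator_cgenidealI[OF _ e ex] generates[OF x(1)] ann x(1) I.Icarr by simp
      then have ee: "e \<otimes> e = \<zero>"
        using ann by (auto simp: annihilator_def)
      \<comment> \<open>Since \<open>r y = 1 - e\<close> and \<open>e\<close> squares to zero, \<open>1 + e\<close> is the inverse of \<open>r y\<close>.\<close>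
      have "((\<one> \<oplus> e) \<otimes> r) \<otimes> y = \<one> \<ominus> e \<otimes> e"
        using r(1) y K.Icarr unfolding e_def by algebra
      then have "((\<one> \<oplus> e) \<otimes> r) \<otimes> y = \<one>"
        using ee by (simp add: minus_eq)
      moreover have "((\<one> \<oplus> e) \<otimes> r) \<otimes> y \<in> K"
        using y e r by (intro K.I_l_closed) auto
      ultimately show False
        using K.one_imp_carrier K(3) by simp
    qed
  qed
  then have "K \<in> vertices (\<bbbA>\<bbbG> R)"
    using V K nonzero_subideal_vertex[of I K] by simp
  then show "K = I"
    using V by simp
qed

text \<open>Without edges every vertex coincides with its annihilator, so the principal ideal of any
  nonzero element of a vertex is squeezed to be the whole vertex.\<close>

lemma edgeless_imp_unique_proper_ideal:
  assumes ne: "vertices (\<bbbA>\<bbbG> R) \<noteq> {}"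
    and edgeless: "\<And>I J. I \<in> vertices (\<bbbA>\<bbbG> R) \<Longrightarrow> J \<in> vertices (\<bbbA>\<bbbG> R) \<Longrightarrow> \<not> adjacent (\<bbbA>\<bbbG> R) I J"
  shows "\<exists>!I. ideal I R \<and> I \<noteq> {\<zero>} \<and> I \<noteq> carrier R"
proof -
  let ?V = "vertices (\<bbbA>\<bbbG> R)"
  have eq: "I = J" if "I \<in> ?V" "J \<in> ?V" "J \<subseteq> annihilator R I" for I J
    using that edgeless[of I J] ideal_prod_eq_zero_iff[of I J]
    by (auto simp: adjacent_annihilating_ideal_graph_iff vertex_iff)
  have ann: "annihilator R I = I" if "I \<in> ?V" for I
    using eq[OF that annihilator_vertex[OF that]] by simp
  have generates: "PIdl x = I" if I: "I \<in> ?V" and x: "x \<in> I" "x \<noteq> \<zero>" for I x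
  proof -
    have id: "ideal I R"
      using I by (simp add: vertex_iff)
    then have "x \<in> carrier R"
      using x ideal.Icarr by fast
    have sub: "PIdl x \<subseteq> I"
      using cgenideal_subset[OF id x(1)] .
    have "PIdl x \<in> ?V"
      using nonzero_subideal_vertex[OF I _ _ sub] \<open>x \<in> carrier R\<close> x
      by (simp add: cgenideal_ideal cgenideal_ne_zero)
    then show ?thesis
      using annihilator_antimono[OF sub] ann I sub by auto
  qed
  obtain I where I: "I \<in> ?V"
    using ne by blast
  have "J = I" if J: "J \<in> ?V" for J
  proof (cases "I \<inter> J \<subseteq> {\<zero>}")
    case True
    interpret I: ideal I R using I by (simp add: vertex_iff)
    interpret J: ideal J R using J by (simp add: vertex_iff)
    have "J \<subseteq> annihilator R I"
    proof
      fix j assume j: "j \<in> J"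
      have "j \<otimes> i \<in> I \<inter> J" if "i \<in> I" for i
        using that j by (simp add: I.I_l_closed J.I_r_closed)
      then show "j \<in> annihilator R I"
        using True j by (auto simp: annihilator_def)
    qed
    then show ?thesis
      using eq[OF I J] by simp
  next
    case False
    then obtain x where "x \<in> I" "x \<in> J" "x \<noteq> \<zero>"
      by blast
    then show ?thesis
      using generates I J by metis
  qed
  then have V: "?V = {I}"
    using I by blast
  have "ideal I R" "I \<noteq> {\<zero>}" "I \<noteq> carrier R"
    using I annihilator_carrier by (auto simp: vertex_iff)
  then show ?thesis
    using proper_ideal_eq_sole_vertex[OF V ann[OF I]] by blast
qed

section \<open>Rings with one nonzero proper ideal\<close>

text \<open>If \<open>I\<close> had zero annihilator, its generator \<open>x\<close> would be regular, and \<open>x\<^sup>2 \<noteq> 0\<close> would generate the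
  same ideal, which makes \<open>x\<close> a unit.\<close>

lemma annihilator_unique_proper_ideal:
  assumes I: "ideal I R" "I \<noteq> {\<zero>}" "I \<noteq> carrier R"
    and unique: "\<And>J. ideal J R \<Longrightarrow> J \<noteq> {\<zero>} \<Longrightarrow> J \<noteq> carrier R \<Longrightarrow> J = I"
  shows "annihilator R I \<noteq> {\<zero>}"
proof
  assume zero: "annihilator R I = {\<zero>}"
  interpret ideal I R by (rule I)
  have generates: "PIdl z = I" if z: "z \<in> I" "z \<noteq> \<zero>" for z
  proof (rule unique)
    show "ideal (PIdl z) R" "PIdl z \<noteq> {\<zero>}"
      using z by (simp_all add: cgenideal_ideal cgenideal_ne_zero)
    show "PIdl z \<noteq> carrier R"
      using cgenideal_subset[OF I(1) z(1)] I(3) a_subset by blast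
  qed
  obtain x where x: "x \<in> I" "x \<noteq> \<zero>" "x \<in> carrier R"
    using ideal_ne_zeroE[OF I(1,2)] .
  have regular: "a = \<zero>" if a: "a \<in> carrier R" "a \<otimes> x = \<zero>" for a
  proof -
    have "a \<in> annihilator R I"
      using annihilator_cgenidealI[OF x(3) a] generates[OF x(1,2)] by simp
    then show ?thesis
      using zero by simp
  qed
  have "x \<otimes> x \<in> I" "x \<otimes> x \<noteq> \<zero>"
    using x regular[of x] by (auto simp: I_l_closed)
  then have "x \<in> PIdl (x \<otimes> x)"
    using generates x by simp
  then obtain r where r: "r \<in> carrier R" "x = r \<otimes> (x \<otimes> x)"
    by (auto simp: cgenideal_def)
  have "(\<one> \<ominus> r \<otimes> x) \<otimes> x = x \<ominus> r \<otimes> (x \<otimes> x)"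
    using r(1) x(3) by algebra
  also have "\<dots> = \<zero>"
    using r(2) x(3) by (simp add: r_neg minus_eq)
  finally have "\<one> \<ominus> r \<otimes> x = \<zero>"
    using regular r(1) x(3) by simp
  moreover have "\<one> = (\<one> \<ominus> r \<otimes> x) \<oplus> r \<otimes> x"
    using r(1) x(3) by algebra
  ultimately have "\<one> = r \<otimes> x"
    using r(1) x(3) by simp
  then show False
    using I_l_closed[OF x(1) r(1)] one_imp_carrier I(3) by simp
qed

end

theorem proposition2p2:
  fixes R :: "('a, 'm) ring_scheme" (structure)
  assumes "cring R"
  shows "\<chi> (\<bbbA>\<bbbG> R) = 1 \<longleftrightarrow> (\<exists>!I. ideal I R \<and> I \<noteq> {\<zero>} \<and> I \<noteq> carrier R)"
proof -
  interpret cring R by fact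
  show ?thesis
  proof
    assume "\<chi> (\<bbbA>\<bbbG> R) = 1"
    then show "\<exists>!I. ideal I R \<and> I \<noteq> {\<zero>} \<and> I \<noteq> carrier R"
      using edgeless_imp_unique_proper_ideal by (simp add: chromatic_number_eq_1_iff)
  next
    assume "\<exists>!I. ideal I R \<and> I \<noteq> {\<zero>} \<and> I \<noteq> carrier R"
    then obtain I where I: "ideal I R" "I \<noteq> {\<zero>}" "I \<noteq> carrier R"
      and unique: "\<And>J. ideal J R \<Longrightarrow> J \<noteq> {\<zero>} \<Longrightarrow> J \<noteq> carrier R \<Longrightarrow> J = I"
      by blast
    have "I \<in> vertices (\<bbbA>\<bbbG> R)"
      using I annihilator_unique_proper_ideal[OF I unique] by (simp add: vertex_iff)
    moreover have "J = I" if "J \<in> vertices (\<bbbA>\<bbbG> R)" for J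
      using that unique annihilator_carrier by (auto simp: vertex_iff)
    ultimately have "vertices (\<bbbA>\<bbbG> R) = {I}"
      by blast
    then show "\<chi> (\<bbbA>\<bbbG> R) = 1"
      by (simp add: chromatic_number_eq_1_iff adjacent_annihilating_ideal_graph_iff)
  qed
qed

end
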